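(* If $G$ is a total $k$-uniform graph, then either $G$ is the disjoint union of $k/2$ stars or the girth of $G$ is at most $6$.
   Context: All graphs are finite and simple. A star is a graph isomorphic to $K_{1,n}$ for some $n\ge 1$. The girth $g(G)$ is the length of a shortest cycle in $G$ (infinite if $G$ is acyclic). $N(v)$ is the set of neighbors of $v$. For a graph $G$ with no isolated vertices, a total dominating set is a set $A\subseteq V(G)$ such that every vertex of $G$ has a neighbor in $A$; $\gamma_t(G)$ is the minimum size of one. A sequence $(v_1,\dots,v_m)$ of distinct vertices is legal if $N(v_i)\setminus\bigcup_{j=1}^{i-1}N(v_j)\neq\emptyset$ for every $i\in\{2,\dots,m\}$; it is a total dominating sequence if moreover $\{v_1,\dots,v_m\}$ is a total dominating set. $\gamma_{gr}^t(G)$ is the maximum length of a total dominating sequence. $G$ is total $k$-uniform if $\gamma_t(G)=\gamma_{gr}^t(G)=k$. *)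

theory Defs
  imports "Graph_Theory.Graph_Theory" "HOL-Library.Extended_Nat"
begin

text \<open>
  Finite simple graphs are the symmetric, loop-free digraphs without parallel arcs
  of the locale \<^locale>\<open>graph\<close>; each undirected edge is a pair of opposite arcs.
\<close>

definition neighbors :: "('a, 'b) pre_digraph \<Rightarrow> 'a \<Rightarrow> 'a set" where
  "neighbors G v = {u. v \<rightarrow>\<^bsub>G\<^esub> u}"

definition no_isolated_vertices :: "('a, 'b) pre_digraph \<Rightarrow> bool" where
  "no_isolated_vertices G \<longleftrightarrow> (\<forall>v\<in>verts G. neighbors G v \<noteq> {})"

definition total_dominating_set :: "('a, 'b) pre_digraph \<Rightarrow> 'a set \<Rightarrow> bool" where
  "total_dominating_set G A \<longleftrightarrow> A \<subseteq> verts G \<and> (\<forall>v\<in>verts G. \<exists>u\<in>A. u \<in> neighbors G v)"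

definition total_domination_number :: "('a, 'b) pre_digraph \<Rightarrow> nat" where
  "total_domination_number G = Min {card A |A. total_dominating_set G A}"

text \<open>Positions are counted from 0, so the first vertex of a sequence is unconstrained.\<close>

definition legal_sequence :: "('a, 'b) pre_digraph \<Rightarrow> 'a list \<Rightarrow> bool" where
  "legal_sequence G vs \<longleftrightarrow> set vs \<subseteq> verts G \<and> distinct vs \<and>
    (\<forall>i\<in>{1..<length vs}. neighbors G (vs ! i) - (\<Union>j<i. neighbors G (vs ! j)) \<noteq> {})"

definition total_dominating_sequence :: "('a, 'b) pre_digraph \<Rightarrow> 'a list \<Rightarrow> bool" where
  "total_dominating_sequence G vs \<longleftrightarrow> legal_sequence G vs \<and> total_dominating_set G (set vs)"

definition grundy_total_domination_number :: "('a, 'b) pre_digraph \<Rightarrow> nat" where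
  "grundy_total_domination_number G = Max {length vs |vs. total_dominating_sequence G vs}"

text \<open>
  In a finite graph without isolated vertices the sets under \<^const>\<open>Min\<close> and \<^const>\<open>Max\<close>
  above are finite and nonempty; otherwise the two numbers carry no meaning, hence the
  first conjunct.
\<close>

definition total_uniform :: "nat \<Rightarrow> ('a, 'b) pre_digraph \<Rightarrow> bool" where
  "total_uniform k G \<longleftrightarrow> no_isolated_vertices G \<and>
    total_domination_number G = k \<and> grundy_total_domination_number G = k"

text \<open>
  A pair of opposite arcs is a directed cycle of length 2; the length bound excludes these,
  and the remaining directed cycles are the undirected cycles with an orientation and a
  starting point. The infimum of the empty set is \<open>\<infinity>\<close>.
\<close>

definition girth :: "('a, 'b) pre_digraph \<Rightarrow> enat" where
  "girth G = (INF p \<in> {p. pre_digraph.cycle G p \<and> 3 \<le> length p}. enat (length p))"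

definition star :: "('a, 'b) pre_digraph \<Rightarrow> bool" where
  "star G \<longleftrightarrow> (\<exists>n\<ge>1. K\<^bsub>1,n\<^esub> G)"

definition disjoint_union_of_stars :: "nat \<Rightarrow> ('a, 'b) pre_digraph \<Rightarrow> bool" where
  "disjoint_union_of_stars m G \<longleftrightarrow>
    (\<exists>Hs. finite Hs \<and> card Hs = m \<and> (\<forall>H\<in>Hs. subgraph H G \<and> star H) \<and>
      pairwise (\<lambda>H H'. verts H \<inter> verts H' = {}) Hs \<and> G = pre_digraph.Union G Hs)"

end

theory Submission
  imports Defs
begin

text \<open>
  Uniformity makes the number of vertices spent on dominating a set independent of the choices
  made: if the neighbourhoods of a legal sequence \<open>S\<close> are covered by those of a vertex set
  \<open>T\<close>, then \<open>|S| \<le> |T|\<close>. Indeed, extend \<open>T\<close> greedily to a total dominating set \<open>T \<union> R\<close>;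
  then \<open>S\<close> followed by \<open>R\<close> is still legal, so \<open>|S| + |R| \<le> k \<le> |T| + |R|\<close>.

  Suppose that the girth exceeds 6 and that \<open>u - w - v - x\<close> is a path. Let \<open>X\<close> consist of the
  vertices other than \<open>u\<close> that have a common neighbour with \<open>u\<close> different from \<open>w\<close>. The absence
  of cycles of length 3, 4 and 6 shows that neither \<open>w\<close> nor \<open>x\<close> has a neighbour in \<open>X\<close>, whereas
  every neighbour of \<open>u\<close> except \<open>w\<close> has one (after excluding leaves, for which the same argument
  works with \<open>X\<close> empty). Hence a legal sequence covering the same as \<open>X\<close> can be followed by \<open>u\<close>
  and then \<open>v\<close>, although \<open>v\<close> alone would dominate the same vertices: a contradiction. So there is
  no path on four vertices, every component is a star, and one centre and one leaf of each star
  form a total dominating sequence, whence \<open>k\<close> is twice the number of stars.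
\<close>

section \<open>Building legal sequences\<close>

lemma legal_sequence_Nil: "legal_sequence G []"
  by (simp add: legal_sequence_def)

text \<open>Turns the indexed condition into a greedy step phrased with the set of vertices already
  chosen. Distinctness comes for free: a repeated vertex has an already covered
  neighbourhood.\<close>

lemma legal_sequence_snoc:
  assumes "no_isolated_vertices G" "legal_sequence G vs" "v \<in> verts G"
    and "\<not> neighbors G v \<subseteq> \<Union>(neighbors G ` set vs)"
  shows "legal_sequence G (vs @ [v])"
proof -
  have *: "(\<Union>j<length vs. neighbors G (vs ! j)) = \<Union>(neighbors G ` set vs)"
    by (auto simp: set_conv_nth)
  have "neighbors G ((vs @ [v]) ! i) - (\<Union>j<i. neighbors G ((vs @ [v]) ! j)) \<noteq> {}"
    if "i \<in> {1..<length (vs @ [v])}" for i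
  proof (cases "i < length vs")
    case True
    have "(\<Union>j<i. neighbors G ((vs @ [v]) ! j)) = (\<Union>j<i. neighbors G (vs ! j))"
      using True by (intro SUP_cong) (auto simp: nth_append)
    then show ?thesis
      using assms(2) that True by (auto simp: legal_sequence_def nth_append)
  next
    case False
    then have i: "i = length vs" using that by auto
    have "(\<Union>j<i. neighbors G ((vs @ [v]) ! j)) = (\<Union>j<i. neighbors G (vs ! j))"
      using i by (intro SUP_cong) (auto simp: nth_append)
    then show ?thesis
      using i * assms(4) by auto
  qed
  moreover have "v \<notin> set vs" using assms(4) by auto
  ultimately show ?thesis
    using assms(2,3) unfolding legal_sequence_def by auto
qed

text \<open>A nonempty neighbourhood disjoint from all earlier ones always contributes something
  new, so the order is irrelevant. This serves for the centres and leaves of a union of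
  stars.\<close>

lemma legal_sequence_pairwise_disjnt:
  assumes "no_isolated_vertices G" "set vs \<subseteq> verts G" "distinct vs"
    and "pairwise (\<lambda>u v. disjnt (neighbors G u) (neighbors G v)) (set vs)"
  shows "legal_sequence G vs"
  using assms(2-)
proof (induction vs rule: rev_induct)
  case Nil
  show ?case by (rule legal_sequence_Nil)
next
  case (snoc v vs)
  have "legal_sequence G vs"
    using snoc by (auto intro: pairwise_subset)
  moreover have "neighbors G v \<noteq> {}"
    using snoc.prems assms(1) by (auto simp: no_isolated_vertices_def)
  moreover have "disjnt (neighbors G v) (neighbors G u)" if "u \<in> set vs" for u
    using snoc.prems that by (auto simp: pairwise_def)
  ultimately show ?case
    using snoc.prems by (intro legal_sequence_snoc[OF assms(1)]) (auto simp: disjnt_iff)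
qed

section \<open>Greedy extension in a finite graph\<close>

context graph
begin

lemma neighbors_sym: "u \<in> neighbors G v \<longleftrightarrow> v \<in> neighbors G u"
  using arcs_ends_symmetric[OF sym_arcs] by (auto simp: neighbors_def)

lemma neighbors_irrefl: "v \<notin> neighbors G v"
  using adj_not_same by (auto simp: neighbors_def)

lemma neighbors_in_verts:
  assumes "u \<in> neighbors G v"
  shows "u \<in> verts G" "v \<in> verts G"
  using assms adj_in_verts by (auto simp: neighbors_def)

lemma finite_length_total_dominating_sequences:
  "finite {length vs |vs. total_dominating_sequence G vs}"
proof (rule finite_subset)
  show "{length vs |vs. total_dominating_sequence G vs} \<subseteq> {..card (verts G)}"
    by (auto simp: total_dominating_sequence_def legal_sequence_def
        distinct_card[symmetric] intro!: card_mono)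
qed simp

lemma finite_card_total_dominating_sets: "finite {card A |A. total_dominating_set G A}"
proof (rule finite_subset)
  show "{card A |A. total_dominating_set G A} \<subseteq> {..card (verts G)}"
    by (auto simp: total_dominating_set_def intro!: card_mono)
qed simp

lemma total_dominating_setI:
  assumes "A \<subseteq> verts G" "verts G \<subseteq> \<Union>(neighbors G ` A)"
  shows "total_dominating_set G A"
  using assms neighbors_sym unfolding total_dominating_set_def by blast

text \<open>As long as some \<open>x\<close> is not covered by \<open>T\<close>, it is not covered
  by \<open>S\<close> either. A neighbour \<open>v\<close> of \<open>x\<close> can therefore be
  appended legally to \<open>S\<close> and added to \<open>T\<close> at the same time; this
  preserves the inclusion of covers and lowers the number of vertices that \<open>T\<close> leaves
  uncovered.\<close>

lemma legal_sequence_complete: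
  assumes "no_isolated_vertices G" "legal_sequence G S" "T \<subseteq> verts G"
    and "\<Union>(neighbors G ` set S) \<subseteq> \<Union>(neighbors G ` T)"
  shows "\<exists>R. legal_sequence G (S @ R) \<and> total_dominating_set G (T \<union> set R)"
  using assms(2-)
proof (induction "card (verts G - \<Union>(neighbors G ` T))" arbitrary: S T rule: less_induct)
  case less
  show ?case
  proof (cases "verts G \<subseteq> \<Union>(neighbors G ` T)")
    case True
    then show ?thesis
      using less.prems total_dominating_setI by (intro exI[of _ "[]"]) auto
  next
    case False
    then obtain x where x: "x \<in> verts G" "x \<notin> \<Union>(neighbors G ` T)" by blast
    then obtain v where v: "v \<in> neighbors G x"
      using assms(1) by (auto simp: no_isolated_vertices_def)
    then have xv: "x \<in> neighbors G v" "v \<in> verts G"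
      using neighbors_sym neighbors_in_verts by blast+
    have "card (verts G - \<Union>(neighbors G ` insert v T)) < card (verts G - \<Union>(neighbors G ` T))"
      using x xv by (intro psubset_card_mono) auto
    moreover have "legal_sequence G (S @ [v])"
      using less.prems x xv by (intro legal_sequence_snoc[OF assms(1)]) blast+
    ultimately obtain R where
      "legal_sequence G ((S @ [v]) @ R)" "total_dominating_set G (insert v T \<union> set R)"
      using less.hyps[of "insert v T" "S @ [v]"] less.prems xv by fastforce
    then show ?thesis
      by (intro exI[of _ "v # R"]) auto
  qed
qed

text \<open>Run through \<open>X\<close> and keep a vertex only if it covers something new.\<close>

lemma legal_sequence_of_set:
  assumes "no_isolated_vertices G" "finite X" "X \<subseteq> verts G"
  shows "\<exists>P. legal_sequence G P \<and> set P \<subseteq> X \<and> \<Union>(neighbors G ` set P) = \<Union>(neighbors G ` X)"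
  using assms(2,3)
proof (induction X)
  case empty
  show ?case by (intro exI[of _ "[]"]) (simp add: legal_sequence_Nil)
next
  case (insert x X)
  then obtain P where P: "legal_sequence G P" "set P \<subseteq> X"
    "\<Union>(neighbors G ` set P) = \<Union>(neighbors G ` X)" by auto
  show ?case
  proof (cases "neighbors G x \<subseteq> \<Union>(neighbors G ` set P)")
    case True
    then show ?thesis using P by (intro exI[of _ P]) auto
  next
    case False
    then have "legal_sequence G (P @ [x])"
      using insert.prems P by (intro legal_sequence_snoc[OF assms(1)]) auto
    then show ?thesis using P by (intro exI[of _ "P @ [x]"]) auto
  qed
qed

section \<open>Exchange arguments from uniformity\<close>

text \<open>The first bound applies to every legal sequence, dominating or not, because completing
  \<open>S\<close> with \<open>T = set S\<close> yields a total dominating sequence that starts with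
  \<open>S\<close>.\<close>

lemma total_uniform_bounds:
  assumes "total_uniform k G"
  shows total_uniform_legal_sequence_le: "legal_sequence G S \<Longrightarrow> length S \<le> k"
    and total_uniform_total_dominating_set_ge: "total_dominating_set G A \<Longrightarrow> k \<le> card A"
proof -
  have G: "no_isolated_vertices G" "total_domination_number G = k"
    "grundy_total_domination_number G = k"
    using assms by (auto simp: total_uniform_def)
  show "k \<le> card A" if "total_dominating_set G A"
    using that G(2) unfolding total_domination_number_def
    by (auto intro!: Min_le finite_card_total_dominating_sets)
  assume S: "legal_sequence G S"
  then obtain R where R: "legal_sequence G (S @ R)" "total_dominating_set G (set S \<union> set R)"
    using legal_sequence_complete[OF G(1) S, of "set S"] by (auto simp: legal_sequence_def)
  then have "length (S @ R) \<le> Max {length vs |vs. total_dominating_sequence G vs}"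
    by (intro Max_ge finite_length_total_dominating_sequences)
      (auto simp: total_dominating_sequence_def intro!: exI[of _ "S @ R"])
  then show "length S \<le> k"
    using G(3) by (simp add: grundy_total_domination_number_def)
qed

lemma total_uniform_length_le_card:
  assumes "total_uniform k G" "legal_sequence G S" "T \<subseteq> verts G"
    and "\<Union>(neighbors G ` set S) \<subseteq> \<Union>(neighbors G ` T)"
  shows "length S \<le> card T"
proof -
  obtain R where R: "legal_sequence G (S @ R)" "total_dominating_set G (T \<union> set R)"
    using legal_sequence_complete[OF _ assms(2-)] assms(1) by (auto simp: total_uniform_def)
  have "length S + length R \<le> k"
    using total_uniform_legal_sequence_le[OF assms(1) R(1)] by simp
  also have "k \<le> card (T \<union> set R)"
    by (rule total_uniform_total_dominating_set_ge[OF assms(1) R(2)])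
  also have "\<dots> \<le> card T + length R"
    using card_Un_le[of T "set R"] card_length[of R] by linarith
  finally show ?thesis by simp
qed

text \<open>Let \<open>P\<close> be a legal sequence covering the same as \<open>X\<close>. If
  \<open>v\<close> still covered something new after \<open>u\<close>, then \<open>P\<close>
  followed by \<open>u\<close> and \<open>v\<close> would be legal, although \<open>v\<close> and
  \<open>P\<close> alone cover the same vertices: |P| + 2 legal steps against at most |P| + 1
  vertices.\<close>

lemma total_uniform_not_nested:
  assumes "total_uniform k G" "X \<subseteq> verts G" "u \<in> verts G" "v \<in> verts G"
    and "neighbors G u \<subseteq> \<Union>(neighbors G ` X) \<union> neighbors G v"
    and "\<not> neighbors G u \<subseteq> \<Union>(neighbors G ` X)"
  shows "neighbors G v \<subseteq> \<Union>(neighbors G ` X) \<union> neighbors G u"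
proof (rule ccontr)
  assume v: "\<not> ?thesis"
  have G: "no_isolated_vertices G" using assms(1) by (simp add: total_uniform_def)
  obtain P where P: "legal_sequence G P" "set P \<subseteq> X"
    "\<Union>(neighbors G ` set P) = \<Union>(neighbors G ` X)"
    using legal_sequence_of_set[OF G finite_subset[OF assms(2)] assms(2)] by auto
  have "legal_sequence G (P @ [u])"
    using P assms by (intro legal_sequence_snoc[OF G]) auto
  then have "legal_sequence G ((P @ [u]) @ [v])"
    using P v assms by (intro legal_sequence_snoc[OF G]) auto
  then have "length ((P @ [u]) @ [v]) \<le> card (insert v (set P))"
    using P assms by (intro total_uniform_length_le_card[OF assms(1)]) auto
  also have "\<dots> \<le> Suc (length P)"
    using card_insert_le_m1[of "Suc (length P)" "set P" v] card_length[of P] by simp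
  finally show False by simp
qed

section \<open>Short cycles and girth\<close>

lemma awalk_of_verts:
  assumes "xs \<noteq> []" "set xs \<subseteq> verts G" "successively (\<lambda>u v. v \<in> neighbors G u) xs"
  shows "\<exists>p. awalk (hd xs) p (last xs) \<and> awalk_verts (hd xs) p = xs"
  using assms
proof (induction xs rule: induct_list012)
  case (2 x)
  then show ?case by (intro exI[of _ "[]"]) (auto simp: awalk_Nil_iff)
next
  case (3 x y xs)
  then obtain p where p: "awalk y p (last (y # xs))" "awalk_verts y p = y # xs" by auto
  from 3 obtain e where e: "e \<in> arcs G" "tail G e = x" "head G e = y"
    by (auto simp: neighbors_def arcs_ends_conv)
  show ?case
    using p e "3.prems" by (intro exI[of _ "e # p"]) (auto simp: awalk_Cons_iff)
qed simp

text \<open>Bridges vertex lists and the arc lists by which cycles are represented: the closed list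
  \<open>xs @ [hd xs]\<close> is the vertex sequence of an arc walk of length
  \<open>length xs\<close>.\<close>

lemma girth_le_length:
  assumes "3 \<le> length xs" "distinct xs" "successively (\<lambda>u v. v \<in> neighbors G u) (xs @ [hd xs])"
  shows "girth G \<le> enat (length xs)"
proof -
  obtain x y ys where xs: "xs = x # y # ys"
    using assms(1) by (auto simp: Suc_le_length_iff numeral_3_eq_3)
  have "set (xs @ [hd xs]) \<subseteq> verts G"
  proof
    fix z assume "z \<in> set (xs @ [hd xs])"
    then have "z \<in> set xs" using xs by auto
    then obtain i where i: "i < length xs" "z = xs ! i" by (auto simp: in_set_conv_nth)
    then have "(xs @ [hd xs]) ! Suc i \<in> neighbors G ((xs @ [hd xs]) ! i)"
      using assms(3) by (simp add: successively_conv_nth)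
    then show "z \<in> verts G" using i neighbors_in_verts by (auto simp: nth_append)
  qed
  then obtain p where p: "awalk x p x" "awalk_verts x p = xs @ [x]"
    using awalk_of_verts[of "xs @ [hd xs]"] assms(3) xs by auto
  then have len: "length p = length xs"
    using length_awalk_verts[of x p] by simp
  have "cycle p"
    unfolding cycle_def using p len assms(2) xs by (intro exI[of _ x]) auto
  then have "girth G \<le> enat (length p)"
    unfolding girth_def using assms(1) len by (intro INF_lower) auto
  then show ?thesis using len by simp
qed

lemma no_short_cycles:
  assumes "girth G > 6"
  shows no_triangle: "\<not> (distinct [a, b, c] \<and> b \<in> neighbors G a \<and> c \<in> neighbors G b
      \<and> a \<in> neighbors G c)"
    and no_square: "\<not> (distinct [a, b, c, d] \<and> b \<in> neighbors G a \<and> c \<in> neighbors G b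
      \<and> d \<in> neighbors G c \<and> a \<in> neighbors G d)"
    and no_hexagon: "\<not> (distinct [a, b, c, d, e, f] \<and> b \<in> neighbors G a \<and> c \<in> neighbors G b
      \<and> d \<in> neighbors G c \<and> e \<in> neighbors G d \<and> f \<in> neighbors G e \<and> a \<in> neighbors G f)"
proof -
  have *: "\<not> (distinct xs \<and> successively (\<lambda>u v. v \<in> neighbors G u) (xs @ [hd xs]))"
    if "3 \<le> length xs" "length xs \<le> 6" for xs
  proof
    assume "distinct xs \<and> successively (\<lambda>u v. v \<in> neighbors G u) (xs @ [hd xs])"
    then have "girth G \<le> enat (length xs)" using that girth_le_length by blast
    also have "\<dots> \<le> enat 6" using that by simp
    finally show False using assms by (simp add: numeral_eq_enat)
  qed
  show "\<not> (distinct [a, b, c] \<and> b \<in> neighbors G a \<and> c \<in> neighbors G b \<and> a \<in> neighbors G c)"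
    using *[of "[a, b, c]"] by simp
  show "\<not> (distinct [a, b, c, d] \<and> b \<in> neighbors G a \<and> c \<in> neighbors G b
      \<and> d \<in> neighbors G c \<and> a \<in> neighbors G d)"
    using *[of "[a, b, c, d]"] by simp
  show "\<not> (distinct [a, b, c, d, e, f] \<and> b \<in> neighbors G a \<and> c \<in> neighbors G b
      \<and> d \<in> neighbors G c \<and> e \<in> neighbors G d \<and> f \<in> neighbors G e \<and> a \<in> neighbors G f)"
    using *[of "[a, b, c, d, e, f]"] by simp
qed

section \<open>Excluding paths on four vertices\<close>

text \<open>The exchange argument with \<open>X\<close> empty: the neighbourhood \<open>{w}\<close>
  of the leaf \<open>u\<close> lies in that of \<open>v\<close>, so the converse inclusion holds
  too.\<close>

lemma total_uniform_leaf_sibling: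
  assumes "total_uniform k G" "neighbors G u = {w}" "v \<in> neighbors G w"
  shows "neighbors G v = {w}"
proof -
  have "w \<in> neighbors G v" "u \<in> verts G" "v \<in> verts G"
    using assms neighbors_sym neighbors_in_verts by blast+
  then show ?thesis
    using total_uniform_not_nested[OF assms(1), of "{}" u v] assms(2) by auto
qed

lemma total_uniform_no_P4:
  assumes unif: "total_uniform k G" and girth: "girth G > 6"
    and path: "w \<in> neighbors G u" "v \<in> neighbors G w" "x \<in> neighbors G v" "u \<noteq> v" "w \<noteq> x"
  shows False
proof -
  define X where "X = {p. \<exists>y\<in>neighbors G u. y \<noteq> w \<and> p \<in> neighbors G y \<and> p \<noteq> u}"
  have verts: "X \<subseteq> verts G" "u \<in> verts G" "v \<in> verts G"
    using path neighbors_in_verts by (auto simp: X_def)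
  have rev: "u \<in> neighbors G w" "w \<in> neighbors G v" "v \<in> neighbors G x"
    using path neighbors_sym by blast+
  have neq: "u \<noteq> w" "w \<noteq> v" "v \<noteq> x"
    using path neighbors_irrefl by blast+
  \<comment> \<open>The hypotheses allow \<open>x = u\<close>; the path would then close up to a
    triangle.\<close>
  have "u \<noteq> x"
    using no_triangle[OF girth, of u w v] path neq by auto
  \<comment> \<open>Otherwise \<open>u\<close>, \<open>y\<close>, \<open>p\<close>, \<open>w\<close>
    form a 4-cycle.\<close>
  have w: "w \<notin> \<Union>(neighbors G ` X)"
  proof
    assume "w \<in> \<Union>(neighbors G ` X)"
    then obtain y p where p: "y \<in> neighbors G u" "y \<noteq> w" "p \<in> neighbors G y" "p \<noteq> u"
      "w \<in> neighbors G p" by (auto simp: X_def)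
    then have "y \<noteq> u" "p \<noteq> y" "p \<noteq> w" using neighbors_irrefl by blast+
    then show False
      using no_square[OF girth, of u y p w] p rev neq by auto
  qed
  \<comment> \<open>Otherwise \<open>u\<close>, \<open>y\<close>, \<open>p\<close>,
    \<open>x\<close>, \<open>v\<close>, \<open>w\<close> form a 6-cycle. Most of the work is
    checking that the six vertices are distinct; \<open>p = v\<close> is impossible because
    \<open>w\<close>, a neighbour of \<open>v\<close>, is not covered by \<open>X\<close>.\<close>
  have x: "x \<notin> \<Union>(neighbors G ` X)"
  proof
    assume "x \<in> \<Union>(neighbors G ` X)"
    then obtain y p where p: "y \<in> neighbors G u" "y \<noteq> w" "p \<in> neighbors G y" "p \<noteq> u"
      "x \<in> neighbors G p" "p \<in> X" by (auto simp: X_def)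
    then have "y \<noteq> u" "p \<noteq> y" "p \<noteq> x" using neighbors_irrefl by blast+
    have "p \<noteq> w" using no_triangle[OF girth, of u y w] p rev neq \<open>y \<noteq> u\<close> by auto
    have "p \<noteq> v" using w rev p(6) by blast
    have "y \<noteq> v" using no_triangle[OF girth, of u v w] p rev neq path by auto
    have "y \<noteq> x" using no_square[OF girth, of u x v w] p rev neq path \<open>u \<noteq> x\<close> by auto
    then show False
      using no_hexagon[OF girth, of u y p x v w] p rev neq path \<open>u \<noteq> x\<close> \<open>y \<noteq> u\<close> \<open>p \<noteq> y\<close> \<open>p \<noteq> x\<close>
        \<open>p \<noteq> w\<close> \<open>p \<noteq> v\<close> \<open>y \<noteq> v\<close> by auto
  qed
  have "y \<in> \<Union>(neighbors G ` X)" if y: "y \<in> neighbors G u" "y \<noteq> w" for y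
  proof -
    have uy: "u \<in> neighbors G y" using y neighbors_sym by blast
    \<comment> \<open>If \<open>y\<close> were a leaf at \<open>u\<close>, its sibling
      \<open>w\<close> would be one as well, but \<open>w\<close> is also adjacent to
      \<open>v\<close>.\<close>
    have "neighbors G y \<noteq> {u}"
      using total_uniform_leaf_sibling[OF unif, of y u w] path rev by auto
    then obtain p where "p \<in> neighbors G y" "p \<noteq> u" using uy by blast
    then show ?thesis using y neighbors_sym by (auto simp: X_def)
  qed
  \<comment> \<open>Among the neighbours of \<open>u\<close>, only \<open>w\<close> is left
    uncovered by \<open>X\<close>, and \<open>v\<close> covers it; so the exchange argument applies.
    It forces \<open>x\<close> to be adjacent to \<open>u\<close>, which closes a 4-cycle.\<close>
  then have "neighbors G v \<subseteq> \<Union>(neighbors G ` X) \<union> neighbors G u"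
    using w path rev by (intro total_uniform_not_nested[OF unif verts]) auto
  then have "x \<in> neighbors G u" using x path by auto
  then show False
    using no_square[OF girth, of u x v w] rev neq path \<open>u \<noteq> x\<close> by auto
qed

section \<open>Components without such paths are stars\<close>

text \<open>
  Below, \<open>x = u\<close> is not excluded, so that the hypothesis \<open>P4_free\<close> rules out triangles as well.
\<close>

lemma P4_free_component_center:
  assumes "no_isolated_vertices G" "H \<in> sccs"
    and P4_free: "\<And>u w v x. w \<in> neighbors G u \<Longrightarrow> v \<in> neighbors G w \<Longrightarrow> x \<in> neighbors G v
      \<Longrightarrow> u \<noteq> v \<Longrightarrow> w \<noteq> x \<Longrightarrow> False"
  obtains c where "c \<in> verts G" "verts H = insert c (neighbors G c)"
    "\<And>y. y \<in> neighbors G c \<Longrightarrow> neighbors G y = {c}"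
proof -
  have V: "verts H \<in> sccs_verts" using assms(2) by (simp add: sccs_verts_conv)
  then obtain v where v: "v \<in> verts H" "v \<in> verts G"
    using sccs_verts_subsets[OF V] unfolding in_sccs_verts_conv_reachable by auto
  have component: "verts H = {y. z \<rightarrow>\<^sup>* y}" if z: "z \<in> verts H" for z
  proof -
    from V have "z \<rightarrow>\<^sup>* y" if "y \<in> verts H" for y
      using z that unfolding in_sccs_verts_conv_reachable by simp
    moreover from V have "y \<in> verts H" if "z \<rightarrow>\<^sup>* y" for y
      using z that symmetric_reachable'[OF that] unfolding in_sccs_verts_conv_reachable by metis
    ultimately show ?thesis by auto
  qed
  from v(2) obtain w where w: "w \<in> neighbors G v"
    using assms(1) by (auto simp: no_isolated_vertices_def)
  \<comment> \<open>If \<open>v\<close> has a single neighbour, that neighbour serves as the centre;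
    otherwise \<open>v\<close> itself does. In the second case each neighbour \<open>y\<close> of
    \<open>v\<close> starts from a path \<open>y' - v - y\<close>, which cannot be prolonged except
    back to \<open>v\<close>.\<close>
  obtain c where c: "c \<in> verts G" "c \<in> verts H" "\<And>y. y \<in> neighbors G c \<Longrightarrow> neighbors G y \<subseteq> {c}"
  proof (cases "neighbors G v = {w}")
    case True
    have "w \<in> verts H"
      using w by (simp add: component[OF v(1)] neighbors_def)
    moreover have "neighbors G y \<subseteq> {w}" if "y \<in> neighbors G w" for y
      using P4_free[OF w that] True by (cases "y = v") auto
    ultimately show ?thesis
      using neighbors_in_verts(1)[OF w] by (intro that)
  next
    case False
    then obtain w' where w': "w' \<in> neighbors G v" "w' \<noteq> w" using w by blast
    have "neighbors G y \<subseteq> {v}" if y: "y \<in> neighbors G v" for y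
    proof -
      obtain y' where y': "y' \<in> neighbors G v" "y' \<noteq> y"
        using w w' by (cases "y = w") auto
      then have "v \<in> neighbors G y'" using neighbors_sym by blast
      then show ?thesis using P4_free[of v y' y] y y' by auto
    qed
    then show ?thesis using v by (intro that)
  qed
  have nb: "neighbors G y = {c}" if "y \<in> neighbors G c" for y
    using c(3)[OF that] that neighbors_sym[of c y] by auto
  have "y \<in> insert c (neighbors G c)" if "c \<rightarrow>\<^sup>* y" for y
    using that
  proof (induction rule: reachable_induct)
    case (step x y)
    then have "y \<in> neighbors G x" by (simp add: neighbors_def)
    then show ?case using step.IH nb by auto
  qed simp
  moreover note component[OF c(2)]
  moreover have "c \<rightarrow>\<^sup>* y" if "y \<in> insert c (neighbors G c)" for y
    using that c by (auto simp: neighbors_def)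
  ultimately have "verts H = insert c (neighbors G c)" by blast
  from that[OF c(1) this nb] show ?thesis .
qed

text \<open>Since each leaf sees only \<open>c\<close>, the arcs of \<open>H\<close> are exactly the
  pairs between \<open>{c}\<close> and \<open>neighbors G c\<close>, in both directions; hence
  \<open>n\<close> is the degree of \<open>c\<close>.\<close>

lemma star_component:
  assumes H: "induced_subgraph H G" and c: "c \<in> verts G" "neighbors G c \<noteq> {}"
    and verts: "verts H = insert c (neighbors G c)"
    and leaf: "\<And>y. y \<in> neighbors G c \<Longrightarrow> neighbors G y = {c}"
  shows "star H"
proof -
  have ends: "arcs_ends H = {c} \<times> neighbors G c \<union> neighbors G c \<times> {c}"
  proof -
    have "arcs_ends H = {(a, b). b \<in> neighbors G a \<and> a \<in> verts H \<and> b \<in> verts H}"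
      using H by (auto simp: induced_subgraph_def subgraph_def compatible_def neighbors_def
          arcs_ends_conv)
    then show ?thesis
      using leaf neighbors_irrefl by (auto simp: verts)
  qed
  have "graph H"
  proof -
    interpret H: digraph H using H by (rule digraphI_induced)
    show ?thesis
      using ends by (intro H.graphI) (auto simp: symmetric_def sym_def)
  qed
  moreover have "card (neighbors G c) \<ge> 1"
    using c finite_subset[of "neighbors G c" "verts G"] neighbors_in_verts
    by (auto simp: Suc_le_eq card_gt_0_iff)
  moreover have "{c} \<inter> neighbors G c = {}"
    using neighbors_irrefl by auto
  ultimately show ?thesis
    unfolding star_def complete_bipartite_digraph_def
    by (intro exI[of _ "card (neighbors G c)"] conjI exI[of _ "{c}"] exI[of _ "neighbors G c"])
      (auto simp: verts ends)
qed

lemma finite_sccs: "finite sccs"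
  using finite_sccs_verts by (simp add: sccs_conv_sccs_verts)

lemma disjoint_verts_sccs: "pairwise (\<lambda>H H'. verts H \<inter> verts H' = {}) sccs"
proof (rule pairwiseI)
  fix H H' assume "H \<in> sccs" "H' \<in> sccs" "H \<noteq> H'"
  then show "verts H \<inter> verts H' = {}"
    using inj_on_verts_sccs by (intro sccs_verts_disjoint) (auto simp: sccs_verts_conv inj_on_def)
qed

lemma P4_free_stars:
  assumes unif: "total_uniform k G"
    and P4_free: "\<And>u w v x. w \<in> neighbors G u \<Longrightarrow> v \<in> neighbors G w \<Longrightarrow> x \<in> neighbors G v
      \<Longrightarrow> u \<noteq> v \<Longrightarrow> w \<noteq> x \<Longrightarrow> False"
  shows "k = 2 * card sccs" "disjoint_union_of_stars (card sccs) G"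
proof -
  have G: "no_isolated_vertices G" using unif by (simp add: total_uniform_def)
  have "\<exists>c. c \<in> verts G \<and> verts H = insert c (neighbors G c)
      \<and> (\<forall>y\<in>neighbors G c. neighbors G y = {c})" if "H \<in> sccs" for H
    by (rule P4_free_component_center[OF G that]) (use P4_free in blast)+
  then obtain c where c: "\<And>H. H \<in> sccs \<Longrightarrow> c H \<in> verts G"
    "\<And>H. H \<in> sccs \<Longrightarrow> verts H = insert (c H) (neighbors G (c H))"
    "\<And>H y. H \<in> sccs \<Longrightarrow> y \<in> neighbors G (c H) \<Longrightarrow> neighbors G y = {c H}"
    by metis
  have "\<exists>l. l \<in> neighbors G (c H)" if "H \<in> sccs" for H
    using c(1)[OF that] G by (auto simp: no_isolated_vertices_def)
  then obtain l where l: "\<And>H. H \<in> sccs \<Longrightarrow> l H \<in> neighbors G (c H)" by metis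

  show "disjoint_union_of_stars (card sccs) G"
    unfolding disjoint_union_of_stars_def
  proof (intro exI[of _ sccs] conjI ballI)
    fix H assume H: "H \<in> sccs"
    then have ind: "induced_subgraph H G" by (rule in_sccs_imp_induced)
    then show "subgraph H G" by (rule induced_imp_subgraph)
    show "star H"
      using star_component[OF ind c(1)[OF H] _ c(2)[OF H] c(3)[OF H]] l[OF H] by blast
  qed (simp_all add: finite_sccs disjoint_verts_sccs graph_is_union_sccs)

  define D where "D = c ` sccs \<union> l ` sccs"
  have mem: "c H \<in> verts H" "l H \<in> verts H" if "H \<in> sccs" for H
    using c(2) l that by auto
  have same: "H = H'" if "H \<in> sccs" "H' \<in> sccs" "x \<in> verts H" "x \<in> verts H'" for H H' x
    using disjoint_verts_sccs that unfolding pairwise_def by blast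
  have cl: "c H \<noteq> l H'" if "H \<in> sccs" "H' \<in> sccs" for H H'
    using same[OF that mem(1)] mem that l neighbors_irrefl by metis
  have inj: "inj_on c sccs" "inj_on l sccs"
    using same mem by (auto intro!: inj_onI) metis+
  \<comment> \<open>The neighbourhoods of the chosen centre and leaf partition the component. Over
    all components, the neighbourhoods of \<open>D\<close> are thus disjoint and cover the graph,
    which bounds \<open>k\<close> from below and from above by \<open>card D\<close>.\<close>
  have nb: "neighbors G (c H) \<subseteq> verts H - {c H}" "neighbors G (l H) = {c H}" if "H \<in> sccs" for H
    using c(2,3)[OF that] l[OF that] neighbors_irrefl by auto
  have D: "finite D" "D \<subseteq> verts G" "card D = 2 * card sccs"
  proof -
    show "finite D" by (simp add: D_def finite_sccs)
    show "D \<subseteq> verts G" using c(1) l neighbors_in_verts by (auto simp: D_def)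
    have "c ` sccs \<inter> l ` sccs = {}" using cl by auto
    then show "card D = 2 * card sccs"
      by (simp add: D_def card_Un_disjoint finite_sccs card_image inj)
  qed
  obtain vs where vs: "set vs = D" "distinct vs"
    using finite_distinct_list[OF D(1)] by blast
  have "pairwise (\<lambda>u v. disjnt (neighbors G u) (neighbors G v)) D"
  proof (rule pairwiseI)
    fix u v assume uv: "u \<in> D" "v \<in> D" "u \<noteq> v"
    obtain H where H: "H \<in> sccs" "u = c H \<or> u = l H" using uv by (auto simp: D_def)
    obtain H' where H': "H' \<in> sccs" "v = c H' \<or> v = l H'" using uv by (auto simp: D_def)
    show "disjnt (neighbors G u) (neighbors G v)"
    proof (cases "H = H'")
      case True
      then show ?thesis using H H' uv nb[of H] by (auto simp: disjnt_def)
    next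
      case False
      have "neighbors G u \<subseteq> verts H" "neighbors G v \<subseteq> verts H'"
        using H H' nb[OF H(1)] nb[OF H'(1)] mem[OF H(1)] mem[OF H'(1)] by auto
      then show ?thesis using same[OF H(1) H'(1)] False by (auto simp: disjnt_iff)
    qed
  qed
  then have "legal_sequence G vs"
    using vs D by (intro legal_sequence_pairwise_disjnt[OF G]) auto
  then have le: "2 * card sccs \<le> k"
    using total_uniform_legal_sequence_le[OF unif] distinct_card[OF vs(2)] vs(1) D(3) by metis
  have "verts G \<subseteq> \<Union>(neighbors G ` D)"
  proof
    fix x assume x: "x \<in> verts G"
    have "verts G = (\<Union>H\<in>sccs. verts H)"
      using arg_cong[OF graph_is_union_sccs, of verts] by (simp add: Union_def)
    then obtain H where H: "H \<in> sccs" "x \<in> verts H" using x by blast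
    then show "x \<in> \<Union>(neighbors G ` D)"
      using c(2)[OF H(1)] nb(2)[OF H(1)] by (auto simp: D_def)
  qed
  then have "k \<le> card D"
    using total_uniform_total_dominating_set_ge[OF unif] total_dominating_setI D by blast
  then show "k = 2 * card sccs" using le D by simp
qed

end

theorem theorem5p4:
  fixes G :: "('a, 'b) pre_digraph" and k :: nat
  assumes "graph G"
    and "total_uniform k G"
  shows "(even k \<and> disjoint_union_of_stars (k div 2) G) \<or> girth G \<le> 6"
proof (cases "girth G \<le> 6")
  case False
  interpret graph G by (rule assms)
  have "k = 2 * card sccs" "disjoint_union_of_stars (card sccs) G"
    using P4_free_stars[OF assms(2) total_uniform_no_P4[OF assms(2)]] False by auto
  then show ?thesis by simp
qed simp

end
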